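(* Let $V$ be a vertex set with $|V|=n\ge 2$ and let $G$ be the disjoint union of $n-1$ spanning arborescences $A_1,\dots,A_{n-1}$ on $V$, each of which is a path. Then $G$ has a rainbow spanning arborescence.
   Context: An arborescence is a connected digraph in which exactly one vertex (the root) has no incoming arc and every other vertex has exactly one incoming arc; it is spanning on $V$ if its vertex set is $V$. A path is an arborescence with exactly one leaf (vertex with no outgoing arc). $G$ is the disjoint union of the arc sets $A_i$ (parallel arcs of different indices allowed). A subgraph $B$ of $G$ is rainbow if $|B\cap A_i|\le 1$ for all $i$. *)

theory Defs
  imports "Graph_Theory.Digraph_Component" "HOL-Library.Disjoint_Sets"
begin

text \<open>
  The library's \<^const>\<open>connected\<close> is connectivity of the underlying undirected graph.
  Finiteness is part of the definition because \<^const>\<open>in_degree\<close> and \<^const>\<open>out_degree\<close>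
  are cardinalities, which are \<open>0\<close> on infinite sets. Loops and parallel arcs are not
  forbidden explicitly; they are excluded by connectivity and the in-degree conditions.
\<close>

definition arborescence :: "('a, 'b) pre_digraph \<Rightarrow> bool" where
  "arborescence T \<longleftrightarrow> fin_digraph T \<and> connected T \<and>
     (\<exists>r \<in> verts T. in_degree T r = 0 \<and> (\<forall>v \<in> verts T - {r}. in_degree T v = 1))"

definition leaf :: "('a, 'b) pre_digraph \<Rightarrow> 'a \<Rightarrow> bool" where
  "leaf T v \<longleftrightarrow> v \<in> verts T \<and> out_degree T v = 0"

definition path_arborescence :: "('a, 'b) pre_digraph \<Rightarrow> bool" where
  "path_arborescence T \<longleftrightarrow> arborescence T \<and> (\<exists>!v. leaf T v)"

text \<open>
  The arcs of a \<open>pre_digraph\<close> carry their own identity, so arcs of different \<open>A i\<close> with the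
  same tail and head are different elements of \<open>arcs G\<close>: disjointness of the arc sets does not
  exclude parallel arcs in \<open>G\<close>.
\<close>

definition disjoint_union_of ::
  "('a, 'b) pre_digraph \<Rightarrow> 'i set \<Rightarrow> ('i \<Rightarrow> ('a, 'b) pre_digraph) \<Rightarrow> bool" where
  "disjoint_union_of G I A \<longleftrightarrow>
     (\<forall>i \<in> I. subgraph (A i) G) \<and>
     verts G = (\<Union>i \<in> I. verts (A i)) \<and>
     arcs G = (\<Union>i \<in> I. arcs (A i)) \<and>
     disjoint_family_on (\<lambda>i. arcs (A i)) I"

definition rainbow ::
  "'i set \<Rightarrow> ('i \<Rightarrow> ('a, 'b) pre_digraph) \<Rightarrow> ('a, 'b) pre_digraph \<Rightarrow> bool" where
  "rainbow I A B \<longleftrightarrow> (\<forall>i \<in> I. card (arcs B \<inter> arcs (A i)) \<le> 1)"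

end

theory Submission
  imports Defs
begin

text \<open>
  Call a vertex set \<open>X\<close> closed for a colour if no arc of that colour leaves \<open>X\<close>. The closed sets
  of a path form a chain, and this makes it possible to choose a root \<open>r\<close> such that every
  \<open>X \<ni> r\<close> is closed for fewer than \<open>card X\<close> colours. For such a root, a largest rainbow
  arborescence rooted at \<open>r\<close> is spanning: otherwise an exchange argument, which needs no
  assumption on the digraphs, finds an \<open>X \<ni> r\<close> that is closed for at least \<open>card X\<close> colours.
\<close>

section \<open>Rainbow arborescences with a prescribed root\<close>

text \<open>
  A rainbow arborescence on \<open>P\<close> rooted at \<open>r\<close>: \<open>p v\<close> is the parent of \<open>v\<close> and \<open>c v\<close> the colour
  of the arc entering \<open>v\<close>; both are irrelevant at \<open>r\<close> and outside \<open>P\<close>. The last conjunct says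
  that every vertex of \<open>P\<close> is reachable from \<open>r\<close>, and implies that parents lie in \<open>P\<close>.
\<close>

definition rainbow_tree ::
  "('c \<Rightarrow> ('a \<times> 'a) set) \<Rightarrow> 'a \<Rightarrow> 'c set \<Rightarrow> 'a set \<Rightarrow> ('a \<Rightarrow> 'a) \<Rightarrow> ('a \<Rightarrow> 'c) \<Rightarrow> bool" where
  "rainbow_tree D r C P p c \<longleftrightarrow>
     r \<in> P \<and> (\<forall>v \<in> P - {r}. c v \<in> C \<and> (p v, v) \<in> D (c v)) \<and> inj_on c (P - {r}) \<and>
     (\<forall>X. r \<in> X \<longrightarrow> X \<subset> P \<longrightarrow> (\<exists>v \<in> P - X. p v \<in> X))"

lemma rainbow_tree_mono:
  assumes "rainbow_tree D r C P p c" "c ` (P - {r}) \<subseteq> C'"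
  shows "rainbow_tree D r C' P p c"
  using assms unfolding rainbow_tree_def by blast

lemma rainbow_tree_singleton: "rainbow_tree D r C {r} p c"
  unfolding rainbow_tree_def by auto

lemma rainbow_tree_cong:
  assumes "rainbow_tree D r C P p c" "\<And>v. v \<in> P - {r} \<Longrightarrow> p' v = p v \<and> c' v = c v"
  shows "rainbow_tree D r C P p' c'"
proof -
  have "inj_on c' (P - {r}) = inj_on c (P - {r})"
    by (rule inj_on_cong) (use assms(2) in auto)
  moreover have "\<exists>v \<in> P - X. p' v \<in> X" if "r \<in> X" "\<exists>v \<in> P - X. p v \<in> X" for X
    using that assms(2) by (metis DiffE DiffI singletonD)
  ultimately show ?thesis
    using assms unfolding rainbow_tree_def by auto
qed

lemma rainbow_tree_extend:
  assumes t: "rainbow_tree D r C P p c"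
    and x: "x \<in> P" and y: "y \<notin> P" and xy: "(x, y) \<in> D j" and j: "j \<in> C" "j \<notin> c ` (P - {r})"
  shows "rainbow_tree D r C (insert y P) (p(y := x)) (c(y := j))"
proof -
  have ry: "y \<noteq> r" and rP: "r \<in> P" using t y unfolding rainbow_tree_def by auto
  have "\<exists>v \<in> insert y P - X. (p(y := x)) v \<in> X" if X: "r \<in> X" "X \<subset> insert y P" for X
  proof (cases "P \<subseteq> X")
    case True
    then have "y \<notin> X" using X by auto
    then show ?thesis using x True by auto
  next
    case False
    then have "X \<inter> P \<subset> P" "r \<in> X \<inter> P" using X rP by auto
    then obtain v where "v \<in> P - X \<inter> P" "p v \<in> X \<inter> P"
      using t unfolding rainbow_tree_def by blast
    then show ?thesis using y by (intro bexI[of _ v]) auto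
  qed
  moreover have "inj_on (c(y := j)) (insert y P - {r})"
  proof -
    have "insert y P - {r} = insert y (P - {r})" using ry by auto
    moreover have "inj_on (c(y := j)) (P - {r})"
      using t y unfolding rainbow_tree_def inj_on_def by auto
    moreover have "(c(y := j)) ` (P - {r}) = c ` (P - {r})"
      using y by (intro image_cong) auto
    ultimately show ?thesis using j y by simp
  qed
  ultimately show ?thesis
    using t xy j y unfolding rainbow_tree_def by auto
qed

text \<open>Here \<open>Q\<close> need not be a subtree of the first tree. A cut \<open>X\<close>
  that does not contain \<open>Q\<close> is crossed inside \<open>Q\<close> by the second tree; one
  that contains \<open>Q\<close> is crossed at a vertex outside \<open>Q\<close>, whose parent is
  unchanged.\<close>

lemma rainbow_tree_override:
  assumes t: "rainbow_tree D r C P p c" and s: "rainbow_tree D r C Q q d" and QP: "Q \<subseteq> P"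
    and disj: "c ` (P - Q) \<inter> d ` (Q - {r}) = {}"
  shows "rainbow_tree D r C P (\<lambda>v. if v \<in> Q then q v else p v) (\<lambda>v. if v \<in> Q then d v else c v)"
    (is "rainbow_tree D r C P ?p ?c")
proof -
  have rQ: "r \<in> Q" using s unfolding rainbow_tree_def by auto
  have "\<exists>v \<in> P - X. ?p v \<in> X" if X: "r \<in> X" "X \<subset> P" for X
  proof (cases "Q \<subseteq> X")
    case True
    obtain v where "v \<in> P - X" "p v \<in> X"
      using t X unfolding rainbow_tree_def by blast
    then show ?thesis using True by (intro bexI[of _ v]) auto
  next
    case False
    then have "X \<inter> Q \<subset> Q" "r \<in> X \<inter> Q" using X rQ by auto
    then obtain v where "v \<in> Q - X \<inter> Q" "q v \<in> X \<inter> Q"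
      using s unfolding rainbow_tree_def by blast
    then show ?thesis using QP by (intro bexI[of _ v]) auto
  qed
  moreover have "inj_on ?c (P - {r})"
  proof (rule inj_onI)
    fix u v assume uv: "u \<in> P - {r}" "v \<in> P - {r}" "?c u = ?c v"
    have inj: "inj_on c (P - {r})" "inj_on d (Q - {r})"
      using s t unfolding rainbow_tree_def by auto
    have sep: "c x \<noteq> d y" if "x \<in> P - Q" "y \<in> Q - {r}" for x y
      using disj that by blast
    show "u = v"
    proof (cases "u \<in> Q"; cases "v \<in> Q")
      assume "u \<in> Q" "v \<in> Q"
      then show ?thesis using inj_onD[OF inj(2)] uv by simp
    next
      assume "u \<in> Q" "v \<notin> Q"
      then show ?thesis using sep[of v u] uv by simp
    next
      assume "u \<notin> Q" "v \<in> Q"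
      then show ?thesis using sep[of u v] uv by simp
    next
      assume "u \<notin> Q" "v \<notin> Q"
      then show ?thesis using inj_onD[OF inj(1)] uv by simp
    qed
  qed
  ultimately show ?thesis
    using s t QP unfolding rainbow_tree_def by auto
qed

text \<open>Redirecting \<open>y\<close> to \<open>x\<close> creates no cycle, because
  \<open>x\<close> lies in \<open>Q\<close>, a subtree through \<open>r\<close> that misses
  \<open>y\<close>. The subtree grown by \<open>y\<close> is spliced into the tree on
  \<open>P\<close>.\<close>

lemma rainbow_tree_exchange:
  assumes t: "rainbow_tree D r C P p c" and s: "rainbow_tree D r C Q p c" and QP: "Q \<subseteq> P"
    and x: "x \<in> Q" and y: "y \<in> P - Q" and xy: "(x, y) \<in> D j"
    and j: "j \<in> C" "j \<notin> c ` (P - {r})"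
  shows "rainbow_tree D r C P (p(y := x)) (c(y := j))"
proof -
  have rQ: "r \<in> Q" using s unfolding rainbow_tree_def by auto
  have inj: "inj_on c (P - {r})" using t unfolding rainbow_tree_def by auto
  have jQ: "j \<notin> c ` (Q - {r})" using j QP by auto
  have s': "rainbow_tree D r C (insert y Q) (p(y := x)) (c(y := j))"
    using rainbow_tree_extend[OF s x _ xy j(1) jQ] y by auto
  have yQP: "insert y Q \<subseteq> P" using QP y by auto
  have "c ` (P - insert y Q) \<inter> (c(y := j)) ` (insert y Q - {r}) = {}"
  proof -
    have "c ` (P - insert y Q) \<inter> c ` (Q - {r}) = c ` ((P - insert y Q) \<inter> (Q - {r}))"
      by (rule inj_on_image_Int[OF inj, symmetric]) (use QP rQ in auto)
    moreover have "(c(y := j)) ` (insert y Q - {r}) \<subseteq> insert j (c ` (Q - {r}))"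
      by auto
    moreover have "j \<notin> c ` (P - insert y Q)" using j rQ by auto
    ultimately show ?thesis by auto
  qed
  from rainbow_tree_override[OF t s' yQP this] show ?thesis
    by (rule rainbow_tree_cong) auto
qed

text \<open>
  Let \<open>C\<^sub>0\<close> be the colours that some tree on \<open>P\<close> leaves unused. A largest subtree \<open>Q \<ni> r\<close>
  coloured by \<open>C\<^sub>0\<close> cannot be left by an unused colour, since exchanging that arc for the arc
  entering its head would enlarge \<open>Q\<close>. The hypotheses are therefore inherited by \<open>Q\<close> and the
  colours not used outside \<open>Q\<close>.
\<close>

lemma obstructing_set_exists:
  assumes "finite P" "finite C" "card P \<le> card C" "rainbow_tree D r C P p c"
    and "\<And>p c j. rainbow_tree D r C P p c \<Longrightarrow> j \<in> C - c ` (P - {r}) \<Longrightarrow> D j `` P \<subseteq> P"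
  shows "\<exists>Q \<subseteq> P. r \<in> Q \<and> card Q \<le> card {j \<in> C. D j `` Q \<subseteq> Q}"
  using assms
proof (induction "card P" arbitrary: P C p c rule: less_induct)
  case less
  note finP = less.prems(1) and finC = less.prems(2) and t = less.prems(4)
  note closed = less.prems(5)
  define C0 where "C0 = {j \<in> C. \<exists>p c. rainbow_tree D r C P p c \<and> j \<notin> c ` (P - {r})}"
  show ?case
  proof (cases "C0 = C")
    case True
    \<comment> \<open>Every colour is omitted by some tree on \<open>P\<close>, so all of
      \<open>C\<close> is closed on \<open>P\<close> and \<open>P\<close> itself is the
      witness.\<close>
    then have "{j \<in> C. D j `` P \<subseteq> P} = C" using closed unfolding C0_def by blast
    moreover have "r \<in> P" using t unfolding rainbow_tree_def by auto
    ultimately show ?thesis using less.prems(3) by auto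
  next
    case False
    \<comment> \<open>The same \<open>p\<close> and \<open>c\<close> must serve on \<open>P\<close>
      and on \<open>Q\<close>: \<open>Q\<close> is a subtree of a tree on \<open>P\<close>, not just
      any tree inside \<open>P\<close>.\<close>
    define good where "good = (\<lambda>Q. Q \<subseteq> P \<and>
      (\<exists>p c. rainbow_tree D r C P p c \<and> rainbow_tree D r C0 Q p c))"
    have "r \<in> P" using t unfolding rainbow_tree_def by simp
    then have good_r: "good {r}"
      using t rainbow_tree_singleton[of D r C0] unfolding good_def by fast
    have "\<forall>Q. good Q \<longrightarrow> card Q < Suc (card P)"
      unfolding good_def using finP by (simp add: card_mono less_Suc_eq_le)
    from ex_has_greatest_nat[OF good_r this]
    obtain Q where "good Q" and max: "\<And>Q'. good Q' \<Longrightarrow> card Q' \<le> card Q"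
      by metis
    then obtain p c where QP: "Q \<subseteq> P" and t: "rainbow_tree D r C P p c"
      and s: "rainbow_tree D r C0 Q p c"
      unfolding good_def by auto
    have finQ: "finite Q" using QP finP by (rule finite_subset)
    have rQ: "r \<in> Q" using s unfolding rainbow_tree_def by auto
    have C0C: "C0 \<subseteq> C" unfolding C0_def by auto
    have inj: "inj_on c (P - {r})" using t unfolding rainbow_tree_def by auto
    \<comment> \<open>The colour \<open>k\<close> occurs in every tree on \<open>P\<close> but not
      inside \<open>Q\<close>, so \<open>Q\<close> is proper and the induction applies.\<close>
    obtain k where k: "k \<in> C" "k \<notin> C0" using False C0C by auto
    then have "k \<in> c ` (P - {r})" using t unfolding C0_def by auto
    moreover have "c ` (Q - {r}) \<subseteq> C0" using s unfolding rainbow_tree_def by auto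
    ultimately have "Q \<noteq> P" using k by auto
    then have less_card: "card Q < card P" using QP finP by (simp add: psubset_card_mono psubsetI)
    \<comment> \<open>Stated for all pairs \<open>p'\<close> and \<open>c'\<close>, not only the
      chosen one, because \<open>closed1\<close> applies it to modified trees.\<close>
    have Q_closed: "D j `` Q \<subseteq> Q"
      if t': "rainbow_tree D r C P p' c'" and s': "rainbow_tree D r C0 Q p' c'"
        and j: "j \<in> C" "j \<notin> c' ` (P - {r})" for p' c' j
    proof (rule ccontr)
      assume "\<not> D j `` Q \<subseteq> Q"
      then obtain x y where xy: "x \<in> Q" "(x, y) \<in> D j" "y \<notin> Q" by auto
      then have y: "y \<in> P" using closed[OF t', of j] j QP by auto
      have j0: "j \<in> C0" using t' j unfolding C0_def by auto
      have jQ: "j \<notin> c' ` (Q - {r})" using j QP by auto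
      have s'': "rainbow_tree D r C Q p' c'"
        using rainbow_tree_mono[OF s'] s' C0C unfolding rainbow_tree_def by blast
      have "good (insert y Q)"
        unfolding good_def
        using rainbow_tree_exchange[OF t' s'' QP xy(1) _ xy(2) j]
          rainbow_tree_extend[OF s' xy(1) xy(3) xy(2) j0 jQ] y xy(3) QP by blast
      from max[OF this] show False using xy(3) finQ by simp
    qed
    \<comment> \<open>\<open>C1\<close> holds the colours available on \<open>Q\<close> when the
      arcs entering \<open>P - Q\<close> stay fixed. Each is either used inside \<open>Q\<close> or
      omitted by the whole tree, hence in \<open>C0\<close>.\<close>
    define C1 where "C1 = C - c ` (P - Q)"
    have C1_C0: "C1 \<subseteq> C0"
    proof
      fix j assume j: "j \<in> C1"
      show "j \<in> C0"
      proof (cases "j \<in> c ` (P - {r})")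
        case True
        then have "j \<in> c ` (Q - {r})" using j unfolding C1_def by auto
        then show ?thesis using s unfolding rainbow_tree_def by auto
      next
        case False
        then show ?thesis using j t unfolding C1_def C0_def by auto
      qed
    qed
    have disj: "c ` (P - Q) \<inter> c ` (Q - {r}) = {}"
    proof -
      have "c ` (P - Q) \<inter> c ` (Q - {r}) = c ` ((P - Q) \<inter> (Q - {r}))"
        by (rule inj_on_image_Int[OF inj, symmetric]) (use QP rQ in auto)
      then show ?thesis by auto
    qed
    have tree1: "rainbow_tree D r C1 Q p c"
      by (rule rainbow_tree_mono[OF s])
        (use s C0C disj in \<open>unfold C1_def rainbow_tree_def, blast\<close>)
    have card1: "card Q \<le> card C1"
    proof -
      have "c ` (P - Q) \<subseteq> C" using t rQ unfolding rainbow_tree_def by auto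
      then have "card C1 = card C - card (c ` (P - Q))"
        unfolding C1_def using finP by (intro card_Diff_subset) auto
      also have "card (c ` (P - Q)) = card (P - Q)"
        by (rule card_image, rule inj_on_subset[OF inj]) (use rQ in auto)
      also have "\<dots> = card P - card Q" using QP finQ by (simp add: card_Diff_subset)
      finally show ?thesis using less.prems(3) less_card by linarith
    qed
    have closed1: "D j `` Q \<subseteq> Q"
      if u: "rainbow_tree D r C1 Q q d" and j: "j \<in> C1 - d ` (Q - {r})" for q d j
    proof -
      \<comment> \<open>The tree on \<open>Q\<close> is spliced into the fixed one; the result still
        omits \<open>j\<close>, so \<open>Q_closed\<close> applies.\<close>
      let ?p = "\<lambda>v. if v \<in> Q then q v else p v" and ?c = "\<lambda>v. if v \<in> Q then d v else c v"
      have d: "d ` (Q - {r}) \<subseteq> C1" using u unfolding rainbow_tree_def by auto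
      have "rainbow_tree D r C Q q d"
        by (rule rainbow_tree_mono[OF u]) (use d C1_def in auto)
      then have "rainbow_tree D r C P ?p ?c"
        by (rule rainbow_tree_override[OF t _ QP]) (use d C1_def in auto)
      moreover have "rainbow_tree D r C0 Q q d"
        by (rule rainbow_tree_mono[OF u]) (use d C1_C0 in auto)
      then have "rainbow_tree D r C0 Q ?p ?c" by (rule rainbow_tree_cong) auto
      moreover have "j \<notin> ?c ` (P - {r})" using j unfolding C1_def by auto
      ultimately show ?thesis using Q_closed j C1_def by blast
    qed
    have "finite C1" using finC C1_def by simp
    then have "\<exists>Q' \<subseteq> Q. r \<in> Q' \<and> card Q' \<le> card {j \<in> C1. D j `` Q' \<subseteq> Q'}"
      by (rule less.hyps[OF less_card finQ _ card1 tree1]) (rule closed1)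
    then obtain Q' where Q': "Q' \<subseteq> Q" "r \<in> Q'"
      "card Q' \<le> card {j \<in> C1. D j `` Q' \<subseteq> Q'}"
      by (elim exE conjE)
    have "card {j \<in> C1. D j `` Q' \<subseteq> Q'} \<le> card {j \<in> C. D j `` Q' \<subseteq> Q'}"
      using finC C1_def by (intro card_mono) auto
    then show ?thesis using Q' QP by (meson order_trans)
  qed
qed

theorem spanning_rainbow_tree_exists:
  assumes finV: "finite V" and finC: "finite C" and card_C: "card V \<le> Suc (card C)"
    and rV: "r \<in> V" and DV: "\<And>j. j \<in> C \<Longrightarrow> D j \<subseteq> V \<times> V"
    and no_obstruction:
      "\<And>X. X \<subset> V \<Longrightarrow> r \<in> X \<Longrightarrow> card {j \<in> C. D j `` X \<subseteq> X} < card X"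
  shows "\<exists>p c. rainbow_tree D r C V p c"
proof -
  define good where "good = (\<lambda>P. P \<subseteq> V \<and> (\<exists>p c. rainbow_tree D r C P p c))"
  have good_r: "good {r}" unfolding good_def using rV rainbow_tree_singleton by fast
  have "\<forall>P. good P \<longrightarrow> card P < Suc (card V)"
    unfolding good_def using finV by (simp add: card_mono less_Suc_eq_le)
  from ex_has_greatest_nat[OF good_r this]
  obtain P where "good P" and max: "\<And>P'. good P' \<Longrightarrow> card P' \<le> card P"
    by metis
  then obtain p c where PV: "P \<subseteq> V" and t: "rainbow_tree D r C P p c"
    unfolding good_def by auto
  have finP: "finite P" using PV finV by (rule finite_subset)
  have "P = V"
  proof (rule ccontr)
    assume "P \<noteq> V"
    then have "P \<subset> V" using PV by auto
    then have "card P \<le> card C" using card_C finV psubset_card_mono[of V P] by linarith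
    moreover have "D j `` P \<subseteq> P"
      if t': "rainbow_tree D r C P p' c'" and j: "j \<in> C - c' ` (P - {r})" for p' c' j
    proof (rule ccontr)
      assume "\<not> D j `` P \<subseteq> P"
      then obtain x y where xy: "x \<in> P" "(x, y) \<in> D j" "y \<notin> P" by auto
      then have "y \<in> V" using DV j by blast
      then have "good (insert y P)"
        unfolding good_def using rainbow_tree_extend[OF t' xy(1,3,2)] j PV by blast
      from max[OF this] show False using xy(3) finP by simp
    qed
    ultimately obtain Q where Q: "Q \<subseteq> P" "r \<in> Q" "card Q \<le> card {j \<in> C. D j `` Q \<subseteq> Q}"
      using obstructing_set_exists[OF finP finC _ t] by blast
    with no_obstruction[of Q] \<open>P \<subset> V\<close> show False by auto
  qed
  with t show ?thesis by blast
qed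

section \<open>Closed sets of a path\<close>

text \<open>A walk in the underlying undirected graph from \<open>X\<close> to a vertex outside must
  cross the boundary, in an unknown direction.\<close>

lemma (in wf_digraph) connected_imp_cut_arc:
  assumes con: "connected G" and X: "X \<subset> verts G" "X \<noteq> {}"
  shows "\<exists>e \<in> arcs G. (tail G e \<in> X) \<noteq> (head G e \<in> X)"
proof (rule ccontr)
  assume no_cut: "\<not> ?thesis"
  obtain u v where uv: "u \<in> X" "v \<in> verts G" "v \<notin> X" using X by auto
  then have "(u, v) \<in> rtrancl_on (verts G) ((arcs_ends G)\<^sup>s)"
    using con X unfolding connected_conv by auto
  then have "v \<in> X"
    by (induction rule: rtrancl_on_induct)
      (use uv no_cut in \<open>auto simp: arcs_ends_conv symcl_def\<close>)
  with uv show False by simp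
qed

lemma arborescence_card_arcs_into:
  assumes "arborescence T" "X \<subseteq> verts T"
  shows "card {e \<in> arcs T. head T e \<in> X} \<le> card X"
proof -
  have fin: "fin_digraph T" and deg: "\<And>v. v \<in> verts T \<Longrightarrow> in_degree T v \<le> 1"
    using assms(1) unfolding arborescence_def by force+
  have finX: "finite X"
    using assms(2) fin_digraph.finite_verts[OF fin] by (rule finite_subset)
  have "{e \<in> arcs T. head T e \<in> X} = (\<Union>v \<in> X. in_arcs T v)"
    by (auto simp: in_arcs_def)
  then have "card {e \<in> arcs T. head T e \<in> X} \<le> (\<Sum>v \<in> X. in_degree T v)"
    using card_UN_le[OF finX] by (simp add: in_degree_def)
  also have "\<dots> \<le> (\<Sum>v \<in> X. 1)"
    by (rule sum_mono) (use deg assms(2) in auto)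
  finally show ?thesis by simp
qed

lemma card_arcs_from:
  assumes fin: "fin_digraph T" and "X \<subseteq> verts T" "\<And>v. v \<in> X \<Longrightarrow> \<not> leaf T v"
  shows "card X \<le> card {e \<in> arcs T. tail T e \<in> X}"
proof (rule surj_card_le)
  show "finite {e \<in> arcs T. tail T e \<in> X}"
    using fin_digraph.finite_arcs[OF fin] by simp
  have "out_arcs T v \<noteq> {}" if "v \<in> X" for v
    using assms(2) assms(3)[OF that] that by (metis card.empty leaf_def out_degree_def subsetD)
  then show "X \<subseteq> tail T ` {e \<in> arcs T. tail T e \<in> X}"
    by (auto simp: out_arcs_def)
qed

text \<open>Without a leaf in \<open>X\<close>, at least \<open>card X\<close> arcs start in
  \<open>X\<close>; all of them end in \<open>X\<close>, where at most \<open>card X\<close> arcs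
  end. The two arc sets then coincide, so no arc crosses the boundary of \<open>X\<close>, contrary
  to connectedness.\<close>

lemma closed_contains_leaf:
  assumes T: "path_arborescence T" and X: "X \<subseteq> verts T" "X \<noteq> {}"
    and closed: "arcs_ends T `` X \<subseteq> X"
  shows "\<exists>v \<in> X. leaf T v"
proof (rule ccontr)
  assume no_leaf: "\<not> ?thesis"
  have arb: "arborescence T" and fin: "fin_digraph T" and con: "connected T"
    using T unfolding path_arborescence_def arborescence_def by auto
  interpret fin_digraph T by (rule fin)
  obtain l where "leaf T l" using T unfolding path_arborescence_def by auto
  then have "X \<subset> verts T" using X no_leaf unfolding leaf_def by auto
  then obtain e where e: "e \<in> arcs T" "(tail T e \<in> X) \<noteq> (head T e \<in> X)"
    using connected_imp_cut_arc[OF con] X by blast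
  let ?F = "{e \<in> arcs T. tail T e \<in> X}" and ?H = "{e \<in> arcs T. head T e \<in> X}"
  have "?F \<subseteq> ?H" using closed by (auto simp: arcs_ends_conv)
  moreover have "card ?H \<le> card ?F"
    using arborescence_card_arcs_into[OF arb X(1)] card_arcs_from[OF fin X(1)] no_leaf
    by fastforce
  ultimately have "?F = ?H" by (intro card_seteq) auto
  then show False using e by auto
qed

text \<open>
  The intersection of two closed sets contains all of its outgoing arcs, hence is entered by at
  most one arc; but both differences would have to be left through it.
\<close>

lemma closed_sets_chain:
  assumes T: "path_arborescence T" and X: "X \<subseteq> verts T" "arcs_ends T `` X \<subseteq> X"
    and Y: "Y \<subseteq> verts T" "arcs_ends T `` Y \<subseteq> Y"
  shows "X \<subseteq> Y \<or> Y \<subseteq> X"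
proof (rule ccontr)
  assume "\<not> ?thesis"
  then have ne: "X - Y \<noteq> {}" "Y - X \<noteq> {}" by auto
  have arb: "arborescence T" and fin: "fin_digraph T"
    using T unfolding path_arborescence_def arborescence_def by auto
  interpret fin_digraph T by (rule fin)
  obtain l where l: "\<And>v. leaf T v \<Longrightarrow> v = l"
    using T unfolding path_arborescence_def by auto
  have leafX: "l \<in> X" and leafY: "l \<in> Y"
    using closed_contains_leaf[OF T X(1) _ X(2)] closed_contains_leaf[OF T Y(1) _ Y(2)] ne l
    by auto
  have leaving: "\<exists>e \<in> arcs T. tail T e \<in> Z \<and> head T e \<notin> Z"
    if Z: "Z \<subseteq> verts T" "Z \<noteq> {}" "l \<notin> Z" for Z
  proof (rule ccontr)
    assume "\<not> ?thesis"
    then have "arcs_ends T `` Z \<subseteq> Z" by (auto simp: arcs_ends_conv)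
    then show False using closed_contains_leaf[OF T Z(1,2)] Z(3) l by auto
  qed
  \<comment> \<open>Each difference misses the leaf \<open>l\<close>, so an arc leaves it; since
    \<open>X\<close> and \<open>Y\<close> are closed, that arc ends in their intersection.\<close>
  obtain e where e: "e \<in> arcs T" "tail T e \<in> X - Y" "head T e \<notin> X - Y"
    using leaving[of "X - Y"] X(1) ne leafY by auto
  obtain f where f: "f \<in> arcs T" "tail T f \<in> Y - X" "head T f \<notin> Y - X"
    using leaving[of "Y - X"] Y(1) ne leafX by auto
  have eW: "head T e \<in> X \<inter> Y" and fW: "head T f \<in> X \<inter> Y"
    using e f X(2) Y(2) by (auto simp: arcs_ends_conv)
  let ?W = "X \<inter> Y"
  \<comment> \<open>Every vertex of \<open>?W\<close> other than \<open>l\<close> starts an arc, so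
    \<open>?F\<close> has at least \<open>card ?W - 1\<close> arcs, all ending in \<open>?W\<close>.
    With \<open>e\<close> and \<open>f\<close> this makes \<open>card ?W + 1\<close>, one more than
    the in-degrees allow.\<close>
  let ?F = "{e \<in> arcs T. tail T e \<in> ?W - {l}}" and ?H = "{e \<in> arcs T. head T e \<in> ?W}"
  have "card (?W - {l}) \<le> card ?F"
    by (rule card_arcs_from[OF fin]) (use X l in auto)
  moreover have "card ?W = Suc (card (?W - {l}))"
    using leafX leafY X(1) finite_verts by (intro card.remove) (auto intro: finite_subset)
  moreover have "card ?H \<le> card ?W"
    using arborescence_card_arcs_into[OF arb] X(1) by blast
  moreover have "card ?F + card {e, f} \<le> card ?H"
  proof -
    have "?F \<union> {e, f} \<subseteq> ?H"
      using X(2) Y(2) e f eW fW by (auto simp: arcs_ends_conv)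
    moreover have "?F \<inter> {e, f} = {}" using e f by auto
    ultimately show ?thesis
      using card_mono[of ?H "?F \<union> {e, f}"] card_Un_disjoint[of ?F "{e, f}"] by auto
  qed
  moreover have "e \<noteq> f" using e f by auto
  then have "card {e, f} = 2" by simp
  ultimately show False by linarith
qed

section \<open>A vertex outside all overfull closed sets\<close>

text \<open>
  By the chain condition, distinct maximal sets \<open>X\<close> closed for at least \<open>card X\<close> colours have no
  colour in common. Together they thus have at most \<open>card C < card V\<close> elements.
\<close>

lemma unobstructed_root_exists:
  assumes finV: "finite V" and finC: "finite C" and card_C: "card C < card V"
    and chain: "\<And>j X Y. j \<in> C \<Longrightarrow> X \<subseteq> V \<Longrightarrow> Y \<subseteq> V \<Longrightarrow> D j `` X \<subseteq> X \<Longrightarrow> D j `` Y \<subseteq> Y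
      \<Longrightarrow> X \<subseteq> Y \<or> Y \<subseteq> X"
  shows "\<exists>r \<in> V. \<forall>X \<subseteq> V. r \<in> X \<longrightarrow> card {j \<in> C. D j `` X \<subseteq> X} < card X"
proof (rule ccontr)
  assume obstructed: "\<not> ?thesis"
  define col where "col = (\<lambda>X. {j \<in> C. D j `` X \<subseteq> X})"
  define S where "S = {X. X \<subseteq> V \<and> card X \<le> card (col X)}"
  define M where "M = {X \<in> S. \<forall>Y \<in> S. X \<subseteq> Y \<longrightarrow> X = Y}"
  have finS: "finite S" using finV unfolding S_def by simp
  then have finM: "finite M" unfolding M_def by simp
  have fincol: "finite (col X)" for X using finC unfolding col_def by simp
  \<comment> \<open>By \<open>obstructed\<close> each vertex lies in a member of \<open>S\<close>,
    and by finiteness in a maximal one.\<close>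
  have "V \<subseteq> \<Union> M"
  proof
    fix v assume "v \<in> V"
    then obtain X where "X \<subseteq> V" "v \<in> X" "\<not> card (col X) < card X"
      using obstructed unfolding col_def by blast
    then have X: "X \<in> S" "v \<in> X" unfolding S_def by auto
    obtain Y where "Y \<in> S" "X \<subseteq> Y" "\<forall>Z \<in> S. Y \<subseteq> Z \<longrightarrow> Y = Z"
      using finite_has_maximal2[OF finS X(1)] by metis
    then show "v \<in> \<Union> M" using X(2) unfolding M_def by auto
  qed
  then have "card V \<le> card (\<Union> M)"
    using finM finV unfolding M_def S_def
    by (intro card_mono) (auto intro: finite_subset)
  also have "\<dots> \<le> (\<Sum>X \<in> M. card X)"
    using card_UN_le[OF finM, of id] by simp
  also have "\<dots> \<le> (\<Sum>X \<in> M. card (col X))"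
    by (rule sum_mono) (simp add: M_def S_def)
  also have "\<dots> = card (\<Union>X \<in> M. col X)"
  proof (rule card_UN_disjoint[symmetric, OF finM])
    show "\<forall>X \<in> M. finite (col X)" using fincol by simp
    show "\<forall>X \<in> M. \<forall>Y \<in> M. X \<noteq> Y \<longrightarrow> col X \<inter> col Y = {}"
    proof (intro ballI impI, rule ccontr)
      fix X Y assume XY: "X \<in> M" "Y \<in> M" "X \<noteq> Y" "col X \<inter> col Y \<noteq> {}"
      then obtain j where j: "j \<in> C" "D j `` X \<subseteq> X" "D j `` Y \<subseteq> Y"
        unfolding col_def by auto
      have "X \<subseteq> V" "Y \<subseteq> V" using XY(1,2) unfolding M_def S_def by auto
      then have "X \<subseteq> Y \<or> Y \<subseteq> X" using chain j by simp
      then show False using XY(1-3) unfolding M_def by auto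
    qed
  qed
  also have "\<dots> \<le> card C" unfolding col_def using finC by (intro card_mono) auto
  finally show False using card_C by simp
qed

section \<open>From parent functions to arborescences\<close>

text \<open>One arc of colour \<open>c v\<close> is chosen for each non-root \<open>v\<close>.
  Disjointness of the arc sets makes the colour of an arc unique, so injectivity of \<open>c\<close>
  gives the rainbow property.\<close>

lemma rainbow_tree_imp_arborescence:
  assumes sub: "\<And>i. i \<in> I \<Longrightarrow> subgraph (A i) G"
    and disj: "disjoint_family_on (\<lambda>i. arcs (A i)) I" and I: "I \<noteq> {}"
    and finV: "finite V" and verts: "\<And>i. i \<in> I \<Longrightarrow> verts (A i) = V"
    and tree: "rainbow_tree (\<lambda>i. arcs_ends (A i)) r I V p c"
  shows "\<exists>B. subgraph B G \<and> rainbow I A B \<and> arborescence B \<and> verts B = V"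
proof -
  let ?V = "V - {r}"
  have ends: "tail (A i) = tail G" "head (A i) = head G" "arcs (A i) \<subseteq> arcs G" if "i \<in> I" for i
    using sub[OF that] by (auto simp: subgraph_def compatible_def)
  have "\<exists>e. e \<in> arcs (A (c v)) \<and> tail G e = p v \<and> head G e = v" if "v \<in> ?V" for v
    using tree that ends unfolding rainbow_tree_def by (force simp: arcs_ends_conv)
  then obtain a where a: "\<And>v. v \<in> ?V \<Longrightarrow> a v \<in> arcs (A (c v)) \<and> tail G (a v) = p v \<and> head G (a v) = v"
    by metis
  have cI: "c v \<in> I" if "v \<in> ?V" for v using tree that unfolding rainbow_tree_def by auto
  have rV: "r \<in> V" using tree unfolding rainbow_tree_def by auto
  have pV: "p v \<in> V" if "v \<in> ?V" for v
  proof -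
    have "wf_digraph (A (c v))" using sub[OF cI[OF that]] by (simp add: subgraph_def)
    then show ?thesis
      using wf_digraph.tail_in_verts a[OF that] verts[OF cI[OF that]] ends[OF cI[OF that]] by metis
  qed
  define B where "B = \<lparr>verts = V, arcs = a ` ?V, tail = tail G, head = head G\<rparr>"
  have wfB: "wf_digraph B"
  proof
    fix e assume "e \<in> arcs B"
    then obtain v where v: "v \<in> ?V" "e = a v" unfolding B_def by auto
    then show "tail B e \<in> verts B" "head B e \<in> verts B"
      using a[OF v(1)] pV[OF v(1)] by (auto simp: B_def)
  qed
  interpret B: wf_digraph B by (rule wfB)
  have finB: "fin_digraph B"
    using finV by unfold_locales (auto simp: B_def)
  have "subgraph B G"
  proof -
    \<comment> \<open>Well-formedness of \<open>G\<close> is part of \<open>subgraph\<close>, so any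
      single index supplies it.\<close>
    obtain i where "i \<in> I" using I by auto
    then have "wf_digraph G" "V \<subseteq> verts G"
      using sub verts by (auto simp: subgraph_def)
    moreover have "a ` ?V \<subseteq> arcs G" using a cI ends by blast
    ultimately show ?thesis
      using wfB by (auto simp: subgraph_def compatible_def B_def)
  qed
  moreover have "rainbow I A B"
    unfolding rainbow_def
  proof
    fix i assume i: "i \<in> I"
    have "u = v" if uv: "u \<in> ?V" "v \<in> ?V" "a u \<in> arcs (A i)" "a v \<in> arcs (A i)" for u v
    proof -
      have "c u = i" "c v = i"
        using a cI i uv disj unfolding disjoint_family_on_def by blast+
      then show ?thesis using tree uv unfolding rainbow_tree_def inj_on_def by auto
    qed
    then have "\<forall>x \<in> arcs B \<inter> arcs (A i). \<forall>y \<in> arcs B \<inter> arcs (A i). x = y"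
      unfolding B_def by auto
    moreover have "finite (arcs B \<inter> arcs (A i))" using finV unfolding B_def by simp
    ultimately show "card (arcs B \<inter> arcs (A i)) \<le> 1"
      by (simp add: card_le_Suc0_iff_eq)
  qed
  moreover have "arborescence B"
    unfolding arborescence_def
  proof (intro conjI finB bexI[of _ r] ballI)
    show "r \<in> verts B" using rV by (simp add: B_def)
    have "in_arcs B r = {}" using a by (force simp: in_arcs_def B_def)
    then show "in_degree B r = 0" by (simp add: in_degree_def)
    fix v assume "v \<in> verts B - {r}"
    then have "in_arcs B v = {a v}" using a by (force simp: in_arcs_def B_def)
    then show "in_degree B v = 1" by (simp add: in_degree_def)
  next
    \<comment> \<open>The cut condition of \<open>rainbow_tree\<close> is applied to the set of
      vertices reachable from \<open>r\<close>: the vertex it yields would be reachable as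
      well.\<close>
    let ?R = "{v \<in> V. r \<rightarrow>\<^sup>*\<^bsub>B\<^esub> v}"
    have "?R = V"
    proof (rule ccontr)
      assume "?R \<noteq> V"
      moreover have r: "r \<in> ?R" using rV B.reachable_refl[of r] by (simp add: B_def)
      ultimately obtain v where v: "v \<in> V - ?R" "p v \<in> ?R"
        using tree unfolding rainbow_tree_def by (metis (no_types, lifting) mem_Collect_eq psubsetI subsetI)
      then have v': "v \<in> ?V" using r by auto
      have "p v \<rightarrow>\<^bsub>B\<^esub> v"
        using a[OF v'] v' by (auto simp: arcs_ends_conv B_def intro!: rev_image_eqI[of "a v"])
      then have "r \<rightarrow>\<^sup>*\<^bsub>B\<^esub> v" using v(2) by (auto intro: B.reachable_adj_trans)
      then show False using v(1) by auto
    qed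
    then have reach: "r \<rightarrow>\<^sup>*\<^bsub>mk_symmetric B\<^esub> v" if "v \<in> V" for v
      using that by (auto intro: B.reachable_mk_symmetricI)
    interpret S: pair_wf_digraph "mk_symmetric B" by (rule B.wellformed_mk_symmetric)
    have "u \<rightarrow>\<^sup>*\<^bsub>mk_symmetric B\<^esub> v" if "u \<in> V" "v \<in> V" for u v
      using symmetric_reachable[OF symmetric_mk_symmetric reach[OF that(1)]] reach[OF that(2)]
      by (rule S.reachable_trans)
    then show "connected B"
      using rV unfolding connected_def strongly_connected_def by (auto simp: B_def)
  qed
  moreover have "verts B = V" by (simp add: B_def)
  ultimately show ?thesis by blast
qed

theorem theorem3p3:
  fixes V :: "'a set" and n :: nat
    and G :: "('a, 'b) pre_digraph" and A :: "nat \<Rightarrow> ('a, 'b) pre_digraph"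
  assumes "finite V" and "card V = n" and "n \<ge> 2"
    and "\<And>i. i \<in> {1..n-1} \<Longrightarrow> path_arborescence (A i) \<and> verts (A i) = V"
    and "disjoint_union_of G {1..n-1} A"
  shows "\<exists>B. subgraph B G \<and> rainbow {1..n-1} A B \<and> arborescence B \<and> verts B = V"
proof -
  let ?I = "{1..n-1}" and ?D = "\<lambda>i. arcs_ends (A i)"
  have sub: "\<And>i. i \<in> ?I \<Longrightarrow> subgraph (A i) G"
    and disj: "disjoint_family_on (\<lambda>i. arcs (A i)) ?I"
    using assms(5) unfolding disjoint_union_of_def by auto
  have verts: "\<And>i. i \<in> ?I \<Longrightarrow> verts (A i) = V" using assms(4) by blast
  have "\<exists>r \<in> V. \<forall>X \<subseteq> V. r \<in> X \<longrightarrow> card {j \<in> ?I. ?D j `` X \<subseteq> X} < card X"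
  proof (rule unobstructed_root_exists)
    fix j X Y
    assume j: "j \<in> ?I" and "X \<subseteq> V" "Y \<subseteq> V" "?D j `` X \<subseteq> X" "?D j `` Y \<subseteq> Y"
    then show "X \<subseteq> Y \<or> Y \<subseteq> X"
      using closed_sets_chain[of "A j"] assms(4)[OF j] by simp
  qed (use assms(1-3) in auto)
  then obtain r where r: "r \<in> V"
    "\<And>X. X \<subseteq> V \<Longrightarrow> r \<in> X \<Longrightarrow> card {j \<in> ?I. ?D j `` X \<subseteq> X} < card X"
    by blast
  have "?D j \<subseteq> V \<times> V" if "j \<in> ?I" for j
    using sub[OF that] verts[OF that] wf_digraph.adj_in_verts[of "A j"]
    by (auto simp: subgraph_def)
  \<comment> \<open>With \<open>n - 1\<close> colours the bound
    \<open>card V <= Suc (card C)\<close> holds with equality.\<close>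
  then obtain p c where "rainbow_tree ?D r ?I V p c"
    using spanning_rainbow_tree_exists[of V ?I r ?D] assms(1-3) r by auto
  then show ?thesis
    using rainbow_tree_imp_arborescence[OF sub disj _ assms(1) verts] assms(3) by auto
qed

end
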